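(* Fix $\sigma\in\mathcal U$. Let $\xi\in\mathcal L^2(L^2)$ be such that $t\mapsto\xi(\omega,t,x+X^\sigma_t)$ is $\mathbb P\otimes dx$-a.e. continuous on $[0,T]$ and $E\int_{\mathbb R^d}\sup_{t\in[0,T]}|\xi(t,x+X^\sigma_t)|^2dx<\infty$. Assume that $\{\xi(t,x+X^\sigma_t)\}_{t\in[0,T]}$ is a supermartingale for almost every $x\in\mathbb R^d$, with $\xi(T)=0$. Then $\mathcal E(\xi)=\xi$, where $\mathcal E(\xi)$ denotes the regular $\sigma$-potential $u$ such that $$u(t,x+X^\sigma_t)=\operatorname{esssup}_{\tau\in\mathscr J_t}E_{\mathscr F_t}\big[\xi(\tau,x+X^\sigma_\tau)1_{\{\tau<T\}}\big],\qquad t\in[0,T],$$ $\mathscr J_t$ being the set of stopping times $\tau$ with $t\le\tau\le T$.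
   Context: Setting. $T\in(0,\infty)$ is fixed. $(\Omega,\mathscr F,\{\mathscr F_t\}_{t\ge0},\mathbb P)$ is a complete filtered probability space carrying an $m$-dimensional Wiener process $W$, $\{\mathscr F_t\}$ being its natural augmented filtration; $E_{\mathscr F_t}$ is conditional expectation. $U\subset\mathbb R^{d\times m}$ is nonempty and bounded; $\mathcal U$ is the set of $U$-valued $\{\mathscr F_t\}$-adapted processes; $X^\sigma_t:=\int_0^t\sigma_s\,dW_s$. $L^2=L^2(\mathbb R^d)$. For a Banach space $V$, $\mathcal S^2(V)$ is the set of $V$-valued adapted continuous processes with $E\sup_{t\in[0,T]}\|X_t\|_V^2<\infty$ and $\mathcal L^2(V)$ the set of $V$-valued adapted processes with $E\int_0^T\|X_t\|_V^2dt<\infty$. Versions with the best available properties are always chosen. $\sigma$-quasi-continuity. A random function $u:\Omega\times[0,T]\times\mathbb R^d\to\bar{\mathbb R}$ is $\sigma$-quasi-continuous if for each $\varepsilon>0$ there is a predictable random set $D^\varepsilon\subset\Omega\times[0,T]\times\mathbb R^d$ such that $\mathbb P$-a.s. the section $D^\varepsilon_\omega$ is open, $u(\omega,\cdot,\cdot)$ is continuous on $(D^\varepsilon_\omega)^c$, and $\mathbb P\otimes dx\big((\omega,x):\exists t\in[0,T]\text{ s.t. }(\omega,t,x+X^\sigma_t(\omega))\in D^\varepsilon\big)\le\varepsilon$. Regular $\sigma$-potential. For $u\in\mathcal L^2(L^2)$ and $s\ge0$ put $P^\sigma_su(t,x)=E_{\mathscr F_t}[u(t+s,x+X^\sigma_{t+s}-X^\sigma_t)]$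 if $t+s\le T$ and $P^\sigma_su(t,x)=0$ otherwise. $u\in\mathcal S^2(L^2)$ is a regular $\sigma$-potential if $u$ is $\sigma$-quasi-continuous, $\lim_{t\to T}u(t,\cdot)=0$ in $L^2$ a.s., $E\int_{\mathbb R^d}\sup_{t\in[0,T]}|u(t,x+X^\sigma_t)|^2dx<\infty$, and $P^\sigma_su(t)\le u(t)$ $\mathbb P\otimes dx$-a.e. for all $(t,s)\in[0,T]\times(0,\infty)$. (When $\xi(T)\le0$, a regular $\sigma$-potential $u$ as in the claim exists.) *)

theory Defs
  imports "HOL-Probability.Probability"
begin

section \<open>The Wiener filtration and its stochastic integral\<close>

definition wiener_process :: "'a measure \<Rightarrow> (real \<Rightarrow> 'a \<Rightarrow> real ^ 'm) \<Rightarrow> bool" where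
  "wiener_process M W \<longleftrightarrow>
     (\<forall>t\<ge>0. W t \<in> borel_measurable M) \<and>
     (AE \<omega> in M. W 0 \<omega> = 0) \<and>
     (AE \<omega> in M. continuous_on {0..} (\<lambda>t. W t \<omega>)) \<and>
     (\<forall>(n::nat) (t :: nat \<Rightarrow> real). 0 \<le> t 0 \<and> mono t \<longrightarrow>
        prob_space.indep_vars M (\<lambda>_. borel) (\<lambda>i \<omega>. W (t (Suc i)) \<omega> - W (t i) \<omega>) {..<n}) \<and>
     (\<forall>s t. 0 \<le> s \<and> s < t \<longrightarrow>
        distributed M lborel (\<lambda>\<omega>. W t \<omega> - W s \<omega>)
          (\<lambda>x. ennreal (\<Prod>i\<in>UNIV. normal_density 0 (sqrt (t - s)) (x $ i))))"

text \<open>For negative indices the filtration below is generated by the null sets alone; this only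
  serves to make it a filtration indexed by the whole real line.\<close>

definition aug_filtration :: "'a measure \<Rightarrow> (real \<Rightarrow> 'a \<Rightarrow> real ^ 'm) \<Rightarrow> real \<Rightarrow> 'a measure" where
  "aug_filtration M W t =
     sigma (space M)
       (null_sets M \<union> {W s -` B \<inter> space M | s B. 0 \<le> s \<and> s \<le> t \<and> B \<in> sets borel})"

text \<open>Adapted processes are also required to be jointly measurable, without which no time integral
  of their paths makes sense.\<close>

definition control_processes ::
  "'a measure \<Rightarrow> (real \<Rightarrow> 'a \<Rightarrow> real ^ 'm) \<Rightarrow> real \<Rightarrow> (real ^ 'm ^ 'd) set
    \<Rightarrow> (real \<Rightarrow> 'a \<Rightarrow> real ^ 'm ^ 'd) set" where
  "control_processes M W T U =
     {\<sigma>. (\<forall>t\<in>{0..T}. \<forall>\<omega>\<in>space M. \<sigma> t \<omega> \<in> U) \<and>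
         (\<forall>t\<in>{0..T}. \<sigma> t \<in> borel_measurable (aug_filtration M W t)) \<and>
         (\<lambda>(t, \<omega>). \<sigma> t \<omega>) \<in> borel_measurable (restrict_space borel {0..T} \<Otimes>\<^sub>M M)}"

text \<open>A triple \<open>(n, s, \<eta>)\<close> encodes the simple process whose value on \<open>(s i, s (i + 1)]\<close>
  is \<open>\<eta> i\<close>, for \<open>i < n\<close>.\<close>

type_synonym ('a, 'm, 'd) simple_data = "nat \<times> (nat \<Rightarrow> real) \<times> (nat \<Rightarrow> 'a \<Rightarrow> ((real, 'm) vec, 'd) vec)"

definition simple_data ::
  "'a measure \<Rightarrow> (real \<Rightarrow> 'a \<Rightarrow> real ^ 'm::finite) \<Rightarrow> ('a, 'm, 'd::finite) simple_data \<Rightarrow> bool" where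
  "simple_data M W = (\<lambda>(n, s, \<eta>).
     0 \<le> s 0 \<and> mono s \<and>
     (\<forall>i<n. \<eta> i \<in> borel_measurable (aug_filtration M W (s i)) \<and>
            (\<exists>C. \<forall>\<omega>\<in>space M. norm (\<eta> i \<omega>) \<le> C)))"

definition simple_process :: "('a, 'm::finite, 'd::finite) simple_data \<Rightarrow> real \<Rightarrow> 'a \<Rightarrow> real ^ 'm ^ 'd" where
  "simple_process = (\<lambda>(n, s, \<eta>) t \<omega>.
     \<Sum>i<n. indicator {s i<..s (Suc i)} t *\<^sub>R \<eta> i \<omega>)"

definition simple_integral ::
  "(real \<Rightarrow> 'a \<Rightarrow> real ^ 'm) \<Rightarrow> ('a, 'm, 'd) simple_data \<Rightarrow> real \<Rightarrow> 'a \<Rightarrow> real ^ 'd" where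
  "simple_integral W = (\<lambda>(n, s, \<eta>) t \<omega>.
     \<Sum>i<n. \<eta> i \<omega> *v (W (min t (s (Suc i))) \<omega> - W (min t (s i)) \<omega>))"

text \<open>\<open>X\<close> is a continuous adapted version of \<open>t \<mapsto> \<integral>\<^sub>0\<^sup>t \<sigma> dW\<close> on \<open>[0, T]\<close>, the integral being the
  mean-square limit of the integrals of simple processes that approximate \<open>\<sigma>\<close>.\<close>

definition is_ito_integral ::
  "'a measure \<Rightarrow> (real \<Rightarrow> 'a \<Rightarrow> real ^ 'm) \<Rightarrow> real \<Rightarrow> (real \<Rightarrow> 'a \<Rightarrow> real ^ 'm ^ 'd)
    \<Rightarrow> (real \<Rightarrow> 'a \<Rightarrow> real ^ 'd) \<Rightarrow> bool" where
  "is_ito_integral M W T \<sigma> X \<longleftrightarrow>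
     (\<forall>t\<in>{0..T}. X t \<in> borel_measurable (aug_filtration M W t)) \<and>
     (AE \<omega> in M. continuous_on {0..T} (\<lambda>t. X t \<omega>)) \<and>
     (\<exists>H :: nat \<Rightarrow> ('a, 'm, 'd) simple_data.
        (\<forall>n. simple_data M W (H n)) \<and>
        (\<lambda>n. \<integral>\<^sup>+ \<omega>. (\<integral>\<^sup>+ t\<in>{0..T}. ennreal ((norm (simple_process (H n) t \<omega> - \<sigma> t \<omega>))\<^sup>2) \<partial>lborel) \<partial>M)
          \<longlonglongrightarrow> 0 \<and>
        (\<forall>t\<in>{0..T}.
          (\<lambda>n. \<integral>\<^sup>+ \<omega>. ennreal ((norm (simple_integral W (H n) t \<omega> - X t \<omega>))\<^sup>2) \<partial>M) \<longlonglongrightarrow> 0))"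

definition supermartingale ::
  "'a measure \<Rightarrow> (real \<Rightarrow> 'a measure) \<Rightarrow> real \<Rightarrow> (real \<Rightarrow> 'a \<Rightarrow> real) \<Rightarrow> bool" where
  "supermartingale M F T Y \<longleftrightarrow>
     (\<forall>t\<in>{0..T}. Y t \<in> borel_measurable (F t) \<and> integrable M (Y t)) \<and>
     (\<forall>s t. 0 \<le> s \<and> s \<le> t \<and> t \<le> T \<longrightarrow> (AE \<omega> in M. real_cond_exp M (F s) (Y t) \<omega> \<le> Y s \<omega>))"

definition stopping_times ::
  "'a measure \<Rightarrow> (real \<Rightarrow> 'a measure) \<Rightarrow> real \<Rightarrow> real \<Rightarrow> ('a \<Rightarrow> real) set" where
  "stopping_times M F T t =
     {\<tau>. stopping_time F \<tau> \<and> (\<forall>\<omega>\<in>space M. t \<le> \<tau> \<omega> \<and> \<tau> \<omega> \<le> T)}"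

text \<open>Essential supremum of a family of random variables (the constant \<open>esssup\<close> of the library is
  the essential supremum of a single function).\<close>

definition is_esssup_family :: "'a measure \<Rightarrow> ('a \<Rightarrow> ereal) set \<Rightarrow> ('a \<Rightarrow> ereal) \<Rightarrow> bool" where
  "is_esssup_family M A g \<longleftrightarrow>
     g \<in> borel_measurable M \<and>
     (\<forall>f\<in>A. AE \<omega> in M. f \<omega> \<le> g \<omega>) \<and>
     (\<forall>h\<in>borel_measurable M. (\<forall>f\<in>A. AE \<omega> in M. f \<omega> \<le> h \<omega>) \<longrightarrow> (AE \<omega> in M. g \<omega> \<le> h \<omega>))"

section \<open>Processes with values in the square-integrable functions\<close>

text \<open>An \<open>L\<^sup>2\<close>-valued process is represented by a jointly measurable random field \<open>u \<omega> t x\<close>, and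
  its adaptedness by measurability of each time slice with respect to the product of \<open>F t\<close>
  and the Borel sets.\<close>

definition adapted_field ::
  "'a measure \<Rightarrow> (real \<Rightarrow> 'a measure) \<Rightarrow> real \<Rightarrow> ('a \<Rightarrow> real \<Rightarrow> real ^ 'd \<Rightarrow> real) \<Rightarrow> bool" where
  "adapted_field M F T u \<longleftrightarrow>
     (\<lambda>(\<omega>, t, x). u \<omega> t x) \<in> borel_measurable (M \<Otimes>\<^sub>M (restrict_space borel {0..T} \<Otimes>\<^sub>M borel)) \<and>
     (\<forall>t\<in>{0..T}. (\<lambda>(\<omega>, x). u \<omega> t x) \<in> borel_measurable (F t \<Otimes>\<^sub>M borel))"

definition square_integrable :: "('b::euclidean_space \<Rightarrow> real) \<Rightarrow> bool" where
  "square_integrable f \<longleftrightarrow> f \<in> borel_measurable borel \<and> integrable lborel (\<lambda>x. (f x)\<^sup>2)"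

definition L2_norm_sq :: "('b::euclidean_space \<Rightarrow> real) \<Rightarrow> ennreal" where
  "L2_norm_sq f = (\<integral>\<^sup>+ x. ennreal ((f x)\<^sup>2) \<partial>lborel)"

definition LL2 ::
  "'a measure \<Rightarrow> (real \<Rightarrow> 'a measure) \<Rightarrow> real \<Rightarrow> ('a \<Rightarrow> real \<Rightarrow> real ^ 'd \<Rightarrow> real) set" where
  "LL2 M F T =
     {u. adapted_field M F T u \<and>
         (AE \<omega> in M. AE t in lborel. t \<in> {0..T} \<longrightarrow> square_integrable (u \<omega> t)) \<and>
         (\<integral>\<^sup>+ \<omega>. (\<integral>\<^sup>+ t\<in>{0..T}. L2_norm_sq (u \<omega> t) \<partial>lborel) \<partial>M) < \<infinity>}"

definition SS2 ::
  "'a measure \<Rightarrow> (real \<Rightarrow> 'a measure) \<Rightarrow> real \<Rightarrow> ('a \<Rightarrow> real \<Rightarrow> real ^ 'd \<Rightarrow> real) set" where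
  "SS2 M F T =
     {u. adapted_field M F T u \<and>
         (AE \<omega> in M. \<forall>t\<in>{0..T}. square_integrable (u \<omega> t)) \<and>
         (AE \<omega> in M. \<forall>t\<in>{0..T}.
            ((\<lambda>s. L2_norm_sq (\<lambda>x. u \<omega> s x - u \<omega> t x)) \<longlongrightarrow> 0) (at t within {0..T})) \<and>
         (\<integral>\<^sup>+ \<omega>. (SUP t\<in>{0..T}. L2_norm_sq (u \<omega> t)) \<partial>M) < \<infinity>}"

text \<open>\<open>E \<integral> sup\<^sub>t |u(t, x + X\<^sub>t)|\<^sup>2 dx\<close>\<close>

definition sup_energy ::
  "'a measure \<Rightarrow> real \<Rightarrow> (real \<Rightarrow> 'a \<Rightarrow> real ^ 'd) \<Rightarrow> ('a \<Rightarrow> real \<Rightarrow> real ^ 'd \<Rightarrow> real) \<Rightarrow> ennreal" where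
  "sup_energy M T X u =
     (\<integral>\<^sup>+ (\<omega>, x). (SUP t\<in>{0..T}. ennreal (\<bar>u \<omega> t (x + X t \<omega>)\<bar>\<^sup>2)) \<partial>(M \<Otimes>\<^sub>M lborel))"

section \<open>Quasi-continuity and regular potentials\<close>

definition predictable :: "'a measure \<Rightarrow> (real \<Rightarrow> 'a measure) \<Rightarrow> real \<Rightarrow> ('a \<times> real) measure" where
  "predictable M F T =
     sigma (space M \<times> {0..T})
       ({A \<times> {0} | A. A \<in> sets (F 0)} \<union>
        {A \<times> {s<..t} | A s t. 0 \<le> s \<and> s < t \<and> t \<le> T \<and> A \<in> sets (F s)})"

text \<open>The exceptional set in the last clause is a projection along the time axis and need not be
  product measurable, so its size is expressed by the outer measure.\<close>

definition quasi_continuous ::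
  "'a measure \<Rightarrow> (real \<Rightarrow> 'a measure) \<Rightarrow> real \<Rightarrow> (real \<Rightarrow> 'a \<Rightarrow> real ^ 'd)
    \<Rightarrow> ('a \<Rightarrow> real \<Rightarrow> real ^ 'd \<Rightarrow> 'b::topological_space) \<Rightarrow> bool" where
  "quasi_continuous M F T X u \<longleftrightarrow>
     (\<forall>\<epsilon>::real. \<epsilon> > 0 \<longrightarrow>
       (\<exists>D \<in> sets (predictable M F T \<Otimes>\<^sub>M borel).
          (AE \<omega> in M.
             openin (top_of_set ({0..T} \<times> UNIV)) {(t, x). ((\<omega>, t), x) \<in> D} \<and>
             continuous_on ({0..T} \<times> UNIV - {(t, x). ((\<omega>, t), x) \<in> D}) (\<lambda>(t, x). u \<omega> t x)) \<and>
          outer_measure_of (M \<Otimes>\<^sub>M lborel)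
            {(\<omega>, x) \<in> space M \<times> UNIV. \<exists>t\<in>{0..T}. ((\<omega>, t), x + X t \<omega>) \<in> D} \<le> ennreal \<epsilon>))"

definition shift_semigroup ::
  "'a measure \<Rightarrow> (real \<Rightarrow> 'a measure) \<Rightarrow> real \<Rightarrow> (real \<Rightarrow> 'a \<Rightarrow> real ^ 'd) \<Rightarrow> real
    \<Rightarrow> ('a \<Rightarrow> real \<Rightarrow> real ^ 'd \<Rightarrow> real) \<Rightarrow> ('a \<Rightarrow> real \<Rightarrow> real ^ 'd \<Rightarrow> real)" where
  "shift_semigroup M F T X s u = (\<lambda>\<omega> t x.
     if t + s \<le> T
     then real_cond_exp M (F t) (\<lambda>\<omega>'. u \<omega>' (t + s) (x + X (t + s) \<omega>' - X t \<omega>')) \<omega>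
     else 0)"

text \<open>The semigroup is a conditional expectation for each fixed \<open>x\<close>, chosen without regard to
  measurability in \<open>x\<close>; hence the inequality below holds for almost every \<open>x\<close>, almost surely.\<close>

definition regular_potential ::
  "'a measure \<Rightarrow> (real \<Rightarrow> 'a measure) \<Rightarrow> real \<Rightarrow> (real \<Rightarrow> 'a \<Rightarrow> real ^ 'd)
    \<Rightarrow> ('a \<Rightarrow> real \<Rightarrow> real ^ 'd \<Rightarrow> real) \<Rightarrow> bool" where
  "regular_potential M F T X u \<longleftrightarrow>
     u \<in> SS2 M F T \<and>
     quasi_continuous M F T X u \<and>
     (AE \<omega> in M. ((\<lambda>t. L2_norm_sq (u \<omega> t)) \<longlongrightarrow> 0) (at_left T)) \<and>
     sup_energy M T X u < \<infinity> \<and>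
     (\<forall>t\<in>{0..T}. \<forall>s>0. AE x in lborel. AE \<omega> in M. shift_semigroup M F T X s u \<omega> t x \<le> u \<omega> t x)"

text \<open>\<open>u\<close> is (a version of) the regular potential \<open>\<E>(\<xi>)\<close>.\<close>

definition is_snell_potential ::
  "'a measure \<Rightarrow> (real \<Rightarrow> 'a measure) \<Rightarrow> real \<Rightarrow> (real \<Rightarrow> 'a \<Rightarrow> real ^ 'd)
    \<Rightarrow> ('a \<Rightarrow> real \<Rightarrow> real ^ 'd \<Rightarrow> real) \<Rightarrow> ('a \<Rightarrow> real \<Rightarrow> real ^ 'd \<Rightarrow> real) \<Rightarrow> bool" where
  "is_snell_potential M F T X \<xi> u \<longleftrightarrow>
     regular_potential M F T X u \<and>
     (\<forall>t\<in>{0..T}. AE x in lborel.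
        is_esssup_family M
          {\<lambda>\<omega>. ereal (real_cond_exp M (F t)
                 (\<lambda>\<omega>'. \<xi> \<omega>' (\<tau> \<omega>') (x + X (\<tau> \<omega>') \<omega>') * indicator {\<omega>''. \<tau> \<omega>'' < T} \<omega>') \<omega>)
           | \<tau>. \<tau> \<in> stopping_times M F T t}
          (\<lambda>\<omega>. ereal (u \<omega> t (x + X t \<omega>))))"

end

theory Submission
  imports Defs
begin

text \<open>Fix \<open>x\<close> outside a null set and write \<open>Y t = \<xi>(t, x + X t)\<close>. This is a continuous
  supermartingale, dominated by an integrable variable, with \<open>Y T = 0\<close>. The reward
  \<open>Y \<tau> 1\<^bsub>{\<tau> < T}\<^esub>\<close> of the stopping problem is then just \<open>Y \<tau>\<close>, and optional sampling says that
  no stopping time \<open>\<tau> \<ge> t\<close> has conditional reward above \<open>Y t\<close>, which \<open>\<tau> = t\<close> attains. Hence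
  \<open>u(t, x + X t) = Y t\<close> almost surely, for each fixed \<open>t\<close>
  (\<open>supermartingale_snell_envelope\<close>).

  The null set may depend on \<open>t\<close>. To remove this dependence, both sides are shown to be
  continuous in \<open>t\<close> for almost every \<open>(\<omega>, x)\<close>, so that agreement at rational times is enough:
  \<open>\<xi>\<close> has this continuity by hypothesis, and \<open>u\<close> because the moving point \<open>(t, x + X t)\<close>
  avoids one of the exceptional sets of quasi-continuity almost surely
  (\<open>quasi_continuous_along_path\<close>). Fubini's theorem and the invariance of Lebesgue measure under
  the shift by \<open>X t \<omega>\<close> then turn equality along the paths into equality of the functions
  \<open>u \<omega> t\<close> and \<open>\<xi> \<omega> t\<close>.

  Optional sampling (\<open>supermartingale_optional_sampling\<close>) is reduced by discretization to the
  nonpositivity of the increments of \<open>Y\<close> over events known at their left end point. The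
  integrable dominating variable that the passage to the limit needs comes from the finite energy
  of \<open>\<xi>\<close> (\<open>AE_integrable_path_bound\<close>).\<close>

section \<open>Null sets of products and translates\<close>

lemma AE_lborel_translate:
  fixes c :: "'b::euclidean_space"
  assumes "AE x in lborel. P x"
  shows "AE x in lborel. P (x + c)"
proof -
  obtain N where N: "{x. \<not> P x} \<subseteq> N" "N \<in> null_sets lborel"
    using assms by (auto simp: eventually_ae_filter)
  have "{x. x - (- c) \<in> N} \<in> null_sets lborel"
    by (rule null_sets_translation[OF N(2)])
  moreover have "{x \<in> space lborel. \<not> P (x + c)} \<subseteq> {x. x - (- c) \<in> N}"
    using N(1) by auto
  ultimately show ?thesis
    unfolding eventually_ae_filter by blast
qed

text \<open>Passing to a measurable null set first makes this hold for properties whose extension is not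
  product measurable, such as continuity of a path.\<close>

lemma (in pair_sigma_finite) AE_pair_swapped:
  assumes "AE z in M1 \<Otimes>\<^sub>M M2. Q z"
  shows "AE y in M2. AE x in M1. Q (x, y)"
proof -
  interpret Q: pair_sigma_finite M2 M1 ..
  obtain N where N: "{z \<in> space (M1 \<Otimes>\<^sub>M M2). \<not> Q z} \<subseteq> N" "N \<in> null_sets (M1 \<Otimes>\<^sub>M M2)"
    using assms by (auto simp: eventually_ae_filter)
  have "AE z in M1 \<Otimes>\<^sub>M M2. z \<notin> N"
    using N(2) by (rule AE_not_in)
  then have "AE z in distr (M2 \<Otimes>\<^sub>M M1) (M1 \<Otimes>\<^sub>M M2) (\<lambda>(x, y). (y, x)). z \<notin> N"
    by (subst (asm) distr_pair_swap)
  then have "AE z in M2 \<Otimes>\<^sub>M M1. (case z of (y, x) \<Rightarrow> (x, y)) \<notin> N"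
    by (rule AE_distrD[rotated]) simp
  from Q.AE_pair[OF this] have "AE y in M2. AE x in M1. (x, y) \<notin> N"
    by simp
  then show ?thesis
  proof (rule AE_mp[OF _ AE_I2], intro impI)
    fix y assume y: "y \<in> space M2" and "AE x in M1. (x, y) \<notin> N"
    from this(2) show "AE x in M1. Q (x, y)"
      by (rule AE_mp[OF _ AE_I2]) (use y N(1) in \<open>auto simp: space_pair_measure\<close>)
  qed
qed

text \<open>Measurable hulls of the \<open>A n\<close> intersect in a null set.\<close>

lemma AE_notin_of_small_outer_measure:
  assumes sub: "\<And>n::nat. A n \<subseteq> space M"
    and small: "\<And>n. outer_measure_of M (A n) \<le> ennreal (1 / real (Suc n))"
  shows "AE z in M. \<exists>n. z \<notin> A n"
proof -
  have "\<exists>E. \<forall>n. E n \<in> sets M \<and> A n \<subseteq> E n \<and> outer_measure_of M (A n) = emeasure M (E n)"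
    using outer_measure_of_attain[OF sub] by (intro choice) blast
  then obtain E where E: "\<And>n. E n \<in> sets M" "\<And>n. A n \<subseteq> E n"
    "\<And>n. outer_measure_of M (A n) = emeasure M (E n)"
    by blast
  have "emeasure M (\<Inter>n. E n) \<le> ennreal (1 / real (Suc n))" for n
  proof -
    have "emeasure M (\<Inter>n. E n) \<le> emeasure M (E n)"
      by (rule emeasure_mono) (use E(1) in auto)
    also have "\<dots> \<le> ennreal (1 / real (Suc n))"
      using small[of n] E(3)[of n] by simp
    finally show ?thesis .
  qed
  moreover have "(\<lambda>n. ennreal (1 / real (Suc n))) \<longlonglongrightarrow> ennreal 0"
    by (intro tendsto_ennrealI LIMSEQ_Suc lim_1_over_n)
  ultimately have "emeasure M (\<Inter>n. E n) \<le> ennreal 0"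
    by (intro LIMSEQ_le_const) auto
  then have "(\<Inter>n. E n) \<in> null_sets M"
    using E(1) by (intro null_setsI) auto
  then have "AE z in M. z \<notin> (\<Inter>n. E n)"
    by (rule AE_not_in)
  then show ?thesis
    by eventually_elim (use E(2) in blast)
qed

lemma (in complete_measure) measurable_AE_eq:
  assumes f: "f \<in> measurable M N" and ae: "AE x in M. f x = g x"
    and g: "\<And>x. x \<in> space M \<Longrightarrow> g x \<in> space N"
  shows "g \<in> measurable M N"
proof (rule measurableI[OF g])
  fix B assume B: "B \<in> sets N"
  show "g -` B \<inter> space M \<in> sets M"
  proof (rule in_sets_AE)
    show "AE x in M. x \<in> f -` B \<inter> space M \<longleftrightarrow> x \<in> g -` B \<inter> space M"
      using ae by eventually_elim auto
  qed (use measurable_sets[OF f B] in auto)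
qed

section \<open>Rational times\<close>

lemma closure_rational_interval:
  assumes "(0::real) < T"
  shows "closure ({0..T} \<inter> \<rat>) = {0..T}"
  using closure_convex_Int_superset[of "{0..T}" "\<rat>"] assms
  by (simp add: Rats_closure_real)

section \<open>Sampling along a grid\<close>

text \<open>For \<open>r \<le> g n\<close> and increasing \<open>g\<close>, the value of \<open>y\<close> at the first grid point not before \<open>r\<close>.
  It is written as a sum of increments because, with a stopping time in place of \<open>r\<close>, the
  weight of the increment over \<open>[g i, g (i + 1)]\<close> is then known at time \<open>g i\<close>.\<close>

definition grid_sample :: "(nat \<Rightarrow> real) \<Rightarrow> nat \<Rightarrow> (real \<Rightarrow> real) \<Rightarrow> real \<Rightarrow> real" where
  "grid_sample g n y r = y (g 0) + (\<Sum>i<n. of_bool (g i < r) * (y (g (Suc i)) - y (g i)))"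

lemma grid_sample_eq:
  assumes "mono g" and "r \<le> g n"
  obtains k where "k \<le> n" "grid_sample g n y r = y (g k)" "r \<le> g k"
    "\<And>i. i < k \<Longrightarrow> g i < r"
proof
  define k where "k = (LEAST k. r \<le> g k)"
  show rk: "r \<le> g k"
    unfolding k_def using assms(2) by (rule LeastI)
  show kn: "k \<le> n"
    unfolding k_def using assms(2) by (rule Least_le)
  show lt: "g i < r" if "i < k" for i
    using not_less_Least[OF that[unfolded k_def]] by simp
  have ge: "\<not> g i < r" if "k \<le> i" for i
    using monoD[OF assms(1) that] rk by linarith
  have "(\<Sum>i<n. of_bool (g i < r) * (y (g (Suc i)) - y (g i))) =
      (\<Sum>i<k. y (g (Suc i)) - y (g i))"
    by (rule sum.mono_neutral_cong_right) (use kn lt ge in auto)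
  also have "\<dots> = y (g k) - y (g 0)"
    by (rule sum_lessThan_telescope)
  finally show "grid_sample g n y r = y (g k)"
    by (simp add: grid_sample_def)
qed

definition equigrid :: "real \<Rightarrow> real \<Rightarrow> nat \<Rightarrow> nat \<Rightarrow> real" where
  "equigrid t T n i = t + (T - t) * (real i / real n)"

lemma equigrid_props:
  assumes "t \<le> T" "n > 0"
  shows "mono (equigrid t T n)" "equigrid t T n 0 = t" "equigrid t T n n = T"
    "i \<le> n \<Longrightarrow> equigrid t T n i \<in> {t..T}"
    "equigrid t T n (Suc i) = equigrid t T n i + (T - t) / real n"
proof -
  show mono: "mono (equigrid t T n)"
    unfolding equigrid_def using assms
    by (intro monoI add_left_mono mult_left_mono divide_right_mono) auto
  show l: "equigrid t T n 0 = t" and r: "equigrid t T n n = T"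
    using assms by (auto simp: equigrid_def)
  show "equigrid t T n i \<in> {t..T}" if "i \<le> n"
    using monoD[OF mono, of 0 i] monoD[OF mono that] l r by simp
  show "equigrid t T n (Suc i) = equigrid t T n i + (T - t) / real n"
    by (simp add: equigrid_def add_divide_distrib algebra_simps)
qed

lemma grid_sample_bound:
  assumes "t \<le> r" "r \<le> T" "n > 0" and b: "\<And>s. s \<in> {t..T} \<Longrightarrow> \<bar>y s\<bar> \<le> z"
  shows "\<bar>grid_sample (equigrid t T n) n y r\<bar> \<le> z"
proof -
  have tT: "t \<le> T" using assms by simp
  obtain k where "k \<le> n" "grid_sample (equigrid t T n) n y r = y (equigrid t T n k)"
    using grid_sample_eq[OF equigrid_props(1)[OF tT \<open>n > 0\<close>], of r n y]
      equigrid_props(3)[OF tT \<open>n > 0\<close>] assms(2) by metis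
  then show ?thesis
    using b equigrid_props(4)[OF tT \<open>n > 0\<close>] by simp
qed

text \<open>The sampled grid point lies within one mesh width to the right of \<open>r\<close>.\<close>

lemma grid_sample_tendsto:
  assumes r: "t \<le> r" "r \<le> T" and y: "continuous_on {t..T} y"
  shows "(\<lambda>n. grid_sample (equigrid t T (Suc n)) (Suc n) y r) \<longlonglongrightarrow> y r"
proof -
  have tT: "t \<le> T" using r by simp
  have "\<exists>\<rho>\<in>{r..T}. grid_sample (equigrid t T (Suc n)) (Suc n) y r = y \<rho> \<and>
      \<rho> \<le> r + (T - t) / real (Suc n)" for n
  proof -
    note g = equigrid_props[OF tT zero_less_Suc[of n]]
    obtain k where k: "k \<le> Suc n" "r \<le> equigrid t T (Suc n) k"
      "grid_sample (equigrid t T (Suc n)) (Suc n) y r = y (equigrid t T (Suc n) k)"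
      "\<And>i. i < k \<Longrightarrow> equigrid t T (Suc n) i < r"
      using grid_sample_eq[OF g(1), of r "Suc n" y] g(3) r(2) by metis
    have "equigrid t T (Suc n) k \<le> r + (T - t) / real (Suc n)"
    proof (cases k)
      case 0
      then show ?thesis using g(2) r tT by (simp add: add_increasing2)
    next
      case (Suc j)
      then show ?thesis using g(5)[of j] k(4)[of j] by simp
    qed
    then show ?thesis using k g(4)[OF k(1)] by auto
  qed
  then obtain \<rho> where \<rho>: "\<And>n. \<rho> n \<in> {r..T}"
    "\<And>n. grid_sample (equigrid t T (Suc n)) (Suc n) y r = y (\<rho> n)"
    "\<And>n. \<rho> n \<le> r + (T - t) / real (Suc n)"
    by metis
  have "(\<lambda>n. r + (T - t) / real (Suc n)) \<longlonglongrightarrow> r + 0"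
    by (intro tendsto_add tendsto_const LIMSEQ_Suc lim_const_over_n)
  then have "\<rho> \<longlonglongrightarrow> r"
    by (intro tendsto_sandwich[OF _ _ tendsto_const, of r \<rho>]) (use \<rho> in auto)
  moreover have "\<rho> n \<in> {t..T}" for n
    using r(1) \<rho>(1)[of n] by auto
  ultimately have "(\<lambda>n. y (\<rho> n)) \<longlonglongrightarrow> y r"
    using r by (intro continuous_on_tendsto_compose[OF y]) auto
  then show ?thesis by (simp add: \<rho>(2))
qed

section \<open>Optional sampling\<close>

text \<open>The hypothesis is applied to the event on which the conditional expectation exceeds \<open>g\<close>,
  which lies in \<open>F\<close>.\<close>

lemma (in finite_measure_subalgebra) real_cond_exp_leI:
  assumes f: "integrable M f" and g: "integrable M g" and gF: "g \<in> borel_measurable F"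
    and le: "\<And>A. A \<in> sets F \<Longrightarrow> (\<integral>x\<in>A. f x \<partial>M) \<le> (\<integral>x\<in>A. g x \<partial>M)"
  shows "AE x in M. real_cond_exp M F f x \<le> g x"
proof -
  let ?c = "real_cond_exp M F f"
  have [measurable]: "?c \<in> borel_measurable F" "g \<in> borel_measurable F"
    using gF by auto
  have ic: "integrable M ?c" by (rule real_cond_exp_int(1)[OF f])
  define A where "A = {x \<in> space F. g x < ?c x}"
  have AF: "A \<in> sets F" unfolding A_def by measurable
  have AM: "A \<in> sets M" using AF subalg by (auto simp: subalgebra_def)
  have i: "integrable M (\<lambda>x. indicator A x * h x)" if "integrable M h" for h :: "'a \<Rightarrow> real"
    using that AM by (rule integrable_real_mult_indicator[rotated, simplified mult.commute[of _ "indicator _ _"]])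
  define d where "d x = indicator A x * (?c x - g x)" for x
  have d: "integrable M d"
    unfolding d_def using i[of "\<lambda>x. ?c x - g x"] ic g by simp
  have d0: "0 \<le> d x" for x
    by (auto simp: d_def A_def indicator_def)
  have "(\<integral>x. d x \<partial>M) = (\<integral>x\<in>A. ?c x \<partial>M) - (\<integral>x\<in>A. g x \<partial>M)"
    using i[OF ic] i[OF g]
    by (simp add: d_def set_lebesgue_integral_def right_diff_distrib)
  also have "\<dots> \<le> 0"
    using le[OF AF] real_cond_exp_intA[OF f AF] by simp
  finally have "(\<integral>x. d x \<partial>M) = 0"
    using integral_nonneg_AE[of d M] d0 by (simp add: antisym)
  then have "AE x in M. d x = 0"
    using integral_nonneg_eq_0_iff_AE[OF d] d0 by simp
  then show ?thesis
  proof (rule AE_mp[OF _ AE_I2], intro impI)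
    fix x assume "x \<in> space M" "d x = 0"
    then show "?c x \<le> g x"
      using subalg by (auto simp: d_def A_def indicator_def subalgebra_def split: if_splits)
  qed
qed

lemma supermartingale_increment:
  assumes M: "prob_space M" and sub: "\<And>t. subalgebra M (F t)"
    and Y: "supermartingale M F T Y" and st: "0 \<le> s" "s \<le> t" "t \<le> T" and A: "A \<in> sets (F s)"
  shows "(\<integral>\<omega>. indicator A \<omega> * (Y t \<omega> - Y s \<omega>) \<partial>M) \<le> 0"
proof -
  interpret prob_space M by fact
  interpret finite_measure_subalgebra M "F s"
    by unfold_locales (rule sub)
  have AM: "A \<in> sets M" using A sub by (auto simp: subalgebra_def)
  have i: "integrable M (Y t)" "integrable M (Y s)"
    using Y st by (auto simp: supermartingale_def)
  have ae: "AE \<omega> in M. real_cond_exp M (F s) (Y t) \<omega> \<le> Y s \<omega>"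
    using Y st by (auto simp: supermartingale_def)
  note m = integrable_mult_indicator[OF AM, simplified]
  have "(\<integral>\<omega>. indicator A \<omega> * (Y t \<omega> - Y s \<omega>) \<partial>M) =
      (\<integral>\<omega>\<in>A. Y t \<omega> \<partial>M) - (\<integral>\<omega>\<in>A. Y s \<omega> \<partial>M)"
    using m[OF i(1)] m[OF i(2)] by (simp add: set_lebesgue_integral_def right_diff_distrib)
  also have "(\<integral>\<omega>\<in>A. Y t \<omega> \<partial>M) = (\<integral>\<omega>\<in>A. real_cond_exp M (F s) (Y t) \<omega> \<partial>M)"
    by (rule real_cond_exp_intA[OF i(1) A])
  also have "\<dots> \<le> (\<integral>\<omega>\<in>A. Y s \<omega> \<partial>M)"
    unfolding set_lebesgue_integral_def
  proof (rule integral_mono_AE)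
    show "AE \<omega> in M. indicator A \<omega> *\<^sub>R real_cond_exp M (F s) (Y t) \<omega> \<le> indicator A \<omega> *\<^sub>R Y s \<omega>"
      using ae by eventually_elim (auto simp: indicator_def)
  qed (use m[OF i(2)] m[OF real_cond_exp_int(1)[OF i(1)]] in simp_all)
  finally show ?thesis by simp
qed

text \<open>With \<open>\<tau>\<close> rounded up to a grid, the stopped value is \<open>Y t\<close> plus the increments of \<open>Y\<close> over
  grid intervals, each weighted by the indicator of \<open>{g i < \<tau>}\<close>. Intersecting with an event of
  \<open>F t\<close> keeps the weight in \<open>F (g i)\<close>, so all these terms have nonpositive expectation. Path
  continuity and domination let the mesh tend to zero. Completeness of \<open>M\<close> makes the stopped
  value \<open>Y \<tau>\<close> measurable, since it is a pointwise limit only almost surely.\<close>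

lemma supermartingale_optional_sampling:
  assumes M: "prob_space M" and cM: "complete_measure M"
    and sub: "\<And>t. subalgebra M (F t)" and filt: "filtration (space M) F"
    and Y: "supermartingale M F T Y"
    and cont: "AE \<omega> in M. continuous_on {0..T} (\<lambda>t. Y t \<omega>)"
    and Z: "integrable M Z" and dom: "AE \<omega> in M. \<forall>t\<in>{0..T}. \<bar>Y t \<omega>\<bar> \<le> Z \<omega>"
    and t: "0 \<le> t" "t \<le> T" and \<tau>: "\<tau> \<in> stopping_times M F T t"
  shows "integrable M (\<lambda>\<omega>. Y (\<tau> \<omega>) \<omega>)"
    and "AE \<omega> in M. real_cond_exp M (F t) (\<lambda>\<omega>. Y (\<tau> \<omega>) \<omega>) \<omega> \<le> Y t \<omega>"
proof -
  interpret prob_space M by fact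
  interpret complete_measure M by fact
  interpret S: finite_measure_subalgebra M "F t"
    by unfold_locales (rule sub)
  define g where "g n = equigrid t T (Suc n)" for n
  define V where "V n \<omega> = grid_sample (g n) (Suc n) (\<lambda>s. Y s \<omega>) (\<tau> \<omega>)" for n \<omega>
  have g: "g n i \<in> {t..T}" if "i \<le> Suc n" for n i
    unfolding g_def using that t by (intro equigrid_props(4)) auto
  have g0: "g n 0 = t" and gm: "mono (g n)" for n
    unfolding g_def using t by (simp_all add: equigrid_props)
  have YI: "integrable M (Y s)" and YF: "Y s \<in> borel_measurable (F s)" if "s \<in> {t..T}" for s
    using Y that t by (auto simp: supermartingale_def)
  have \<tau>b: "t \<le> \<tau> \<omega>" "\<tau> \<omega> \<le> T" if "\<omega> \<in> space M" for \<omega>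
    using \<tau> that by (auto simp: stopping_times_def)
  have late: "{\<omega> \<in> space M. s < \<tau> \<omega>} \<in> sets (F s)" for s
  proof -
    have "Measurable.pred (F s) (\<lambda>\<omega>. \<tau> \<omega> \<le> s)"
      using \<tau> by (auto simp: stopping_times_def stopping_time_def)
    then have "{\<omega> \<in> space (F s). \<not> \<tau> \<omega> \<le> s} \<in> sets (F s)"
      by measurable
    moreover have "space (F s) = space M"
      using sub by (auto simp: subalgebra_def)
    ultimately show ?thesis by (simp add: not_le)
  qed
  have V_eq: "V n \<omega> = Y t \<omega> + (\<Sum>i<Suc n. indicator {\<omega> \<in> space M. g n i < \<tau> \<omega>} \<omega> *
      (Y (g n (Suc i)) \<omega> - Y (g n i) \<omega>))" if "\<omega> \<in> space M" for n \<omega>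
    using that unfolding V_def grid_sample_def g0
    by (intro arg_cong2[where f="(+)"] sum.cong refl) (auto simp: indicator_def)
  have lateM: "{\<omega> \<in> space M. s < \<tau> \<omega>} \<in> sets M" for s
    using late sub by (auto simp: subalgebra_def)
  have term_int: "integrable M (\<lambda>\<omega>. indicator {\<omega> \<in> space M. g n i < \<tau> \<omega>} \<omega> *
      (Y (g n (Suc i)) \<omega> - Y (g n i) \<omega>))" if "i < Suc n" for n i
    using integrable_mult_indicator[OF lateM, of "\<lambda>\<omega>. Y (g n (Suc i)) \<omega> - Y (g n i) \<omega>"]
      YI g[of i n] g[of "Suc i" n] that by simp
  have V_int: "integrable M (V n)" for n
    using YI[of t] t
    by (subst Bochner_Integration.integrable_cong[OF refl V_eq])
      (simp, intro Bochner_Integration.integrable_add Bochner_Integration.integrable_sum term_int,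
        simp_all)
  have V_lim: "AE \<omega> in M. (\<lambda>n. V n \<omega>) \<longlonglongrightarrow> Y (\<tau> \<omega>) \<omega>"
    using cont
  proof (rule AE_mp[OF _ AE_I2], intro impI)
    fix \<omega> assume \<omega>: "\<omega> \<in> space M" and c: "continuous_on {0..T} (\<lambda>t. Y t \<omega>)"
    show "(\<lambda>n. V n \<omega>) \<longlonglongrightarrow> Y (\<tau> \<omega>) \<omega>"
      unfolding V_def g_def using \<tau>b[OF \<omega>] t
      by (intro grid_sample_tendsto continuous_on_subset[OF c]) auto
  qed
  have V_dom: "AE \<omega> in M. norm (V n \<omega>) \<le> Z \<omega>" for n
    using dom
  proof (rule AE_mp[OF _ AE_I2], intro impI)
    fix \<omega> assume \<omega>: "\<omega> \<in> space M" and d: "\<forall>t\<in>{0..T}. \<bar>Y t \<omega>\<bar> \<le> Z \<omega>"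
    show "norm (V n \<omega>) \<le> Z \<omega>"
      unfolding V_def g_def real_norm_def using \<tau>b[OF \<omega>] t d
      by (intro grid_sample_bound) auto
  qed
  have V_meas [measurable]: "V n \<in> borel_measurable M" for n
    using V_int by auto
  have Y_meas: "(\<lambda>\<omega>. Y (\<tau> \<omega>) \<omega>) \<in> borel_measurable M"
  proof (rule measurable_AE_eq)
    show "(\<lambda>\<omega>. lim (\<lambda>n. V n \<omega>)) \<in> borel_measurable M"
      by measurable
    show "AE \<omega> in M. lim (\<lambda>n. V n \<omega>) = Y (\<tau> \<omega>) \<omega>"
      using V_lim by eventually_elim (rule limI)
  qed simp
  show Y\<tau>: "integrable M (\<lambda>\<omega>. Y (\<tau> \<omega>) \<omega>)"
    by (rule integrable_dominated_convergence[OF Y_meas V_meas Z V_lim V_dom])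
  show "AE \<omega> in M. real_cond_exp M (F t) (\<lambda>\<omega>. Y (\<tau> \<omega>) \<omega>) \<omega> \<le> Y t \<omega>"
  proof (rule S.real_cond_exp_leI[OF Y\<tau> YI YF])
    fix A assume A: "A \<in> sets (F t)"
    then have AM: "A \<in> sets M" using sub by (auto simp: subalgebra_def)
    have le: "(\<integral>\<omega>\<in>A. V n \<omega> \<partial>M) \<le> (\<integral>\<omega>\<in>A. Y t \<omega> \<partial>M)" for n
    proof -
      let ?B = "\<lambda>i. A \<inter> {\<omega> \<in> space M. g n i < \<tau> \<omega>}"
      have B_int: "integrable M (\<lambda>\<omega>. indicator (?B i) \<omega> * (Y (g n (Suc i)) \<omega> - Y (g n i) \<omega>))"
        if "i < Suc n" for i
        using integrable_mult_indicator[OF AM term_int[OF that]]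
        by (simp add: indicator_inter_arith mult.assoc)
      have "(\<integral>\<omega>\<in>A. V n \<omega> \<partial>M) = (\<integral>\<omega>. indicator A \<omega> * Y t \<omega> + (\<Sum>i<Suc n. indicator (?B i) \<omega> *
          (Y (g n (Suc i)) \<omega> - Y (g n i) \<omega>)) \<partial>M)"
        unfolding set_lebesgue_integral_def
        by (rule Bochner_Integration.integral_cong)
          (simp_all only: V_eq real_scaleR_def distrib_left sum_distrib_left indicator_inter_arith
            mult.assoc)
      also have "\<dots> = (\<integral>\<omega>\<in>A. Y t \<omega> \<partial>M) + (\<Sum>i<Suc n. \<integral>\<omega>. indicator (?B i) \<omega> *
          (Y (g n (Suc i)) \<omega> - Y (g n i) \<omega>) \<partial>M)"
        unfolding set_lebesgue_integral_def real_scaleR_def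
      proof (subst Bochner_Integration.integral_add)
        show "integrable M (\<lambda>\<omega>. indicator A \<omega> * Y t \<omega>)"
          using integrable_mult_indicator[OF AM YI[of t]] t by simp
        show "integrable M (\<lambda>\<omega>. \<Sum>i<Suc n. indicator (?B i) \<omega> *
            (Y (g n (Suc i)) \<omega> - Y (g n i) \<omega>))"
          by (rule Bochner_Integration.integrable_sum, rule B_int, simp)
      qed (subst Bochner_Integration.integral_sum, rule B_int, simp_all only: lessThan_iff)
      also have "\<dots> \<le> (\<integral>\<omega>\<in>A. Y t \<omega> \<partial>M) + 0"
      proof (intro add_left_mono sum_nonpos)
        fix i assume "i \<in> {..<Suc n}"
        then have i: "i < Suc n" by simp
        have "?B i \<in> sets (F (g n i))"
          using A filtration.sets_F_mono[OF filt, of t "g n i"] g[of i n] i late[of "g n i"] by auto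
        then show "(\<integral>\<omega>. indicator (?B i) \<omega> * (Y (g n (Suc i)) \<omega> - Y (g n i) \<omega>) \<partial>M) \<le> 0"
          using g[of i n] g[of "Suc i" n] monoD[OF gm, of i "Suc i" n] i t
          by (intro supermartingale_increment[OF M sub Y]) auto
      qed
      finally show ?thesis by simp
    qed
    have "(\<lambda>n. \<integral>\<omega>\<in>A. V n \<omega> \<partial>M) \<longlonglongrightarrow> (\<integral>\<omega>\<in>A. Y (\<tau> \<omega>) \<omega> \<partial>M)"
      unfolding set_lebesgue_integral_def
    proof (rule integral_dominated_convergence[OF _ _ Z])
      show "AE \<omega> in M. (\<lambda>n. indicator A \<omega> *\<^sub>R V n \<omega>) \<longlonglongrightarrow> indicator A \<omega> *\<^sub>R Y (\<tau> \<omega>) \<omega>"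
        using V_lim by eventually_elim (intro tendsto_intros)
      show "AE \<omega> in M. norm (indicator A \<omega> *\<^sub>R V n \<omega>) \<le> Z \<omega>" for n
        using V_dom[of n] by eventually_elim (auto simp: indicator_def)
    qed (use Y_meas AM in measurable)
    then show "(\<integral>\<omega>\<in>A. Y (\<tau> \<omega>) \<omega> \<partial>M) \<le> (\<integral>\<omega>\<in>A. Y t \<omega> \<partial>M)"
      by (rule LIMSEQ_le_const2) (use le in auto)
  qed (use t in auto)
qed

section \<open>The Snell envelope of a supermartingale\<close>

lemma esssup_family_attained:
  assumes g: "is_esssup_family M A g" and h: "h \<in> borel_measurable M"
    and ub: "\<And>f. f \<in> A \<Longrightarrow> AE \<omega> in M. f \<omega> \<le> h \<omega>"
    and f: "f \<in> A" "AE \<omega> in M. f \<omega> = h \<omega>"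
  shows "AE \<omega> in M. g \<omega> = h \<omega>"
proof -
  have "AE \<omega> in M. g \<omega> \<le> h \<omega>"
    using g h ub by (simp add: is_esssup_family_def)
  moreover have "AE \<omega> in M. f \<omega> \<le> g \<omega>"
    using g f(1) by (simp add: is_esssup_family_def)
  ultimately show ?thesis
    using f(2) by eventually_elim (auto intro: antisym)
qed

text \<open>Stopping a supermartingale at once is optimal. Since \<open>Y T = 0\<close>, the indicator in the reward
  changes nothing, even for \<open>t = T\<close>, where it kills every reward.\<close>

lemma supermartingale_snell_envelope:
  assumes M: "prob_space M" and cM: "complete_measure M"
    and sub: "\<And>t. subalgebra M (F t)" and filt: "filtration (space M) F"
    and Y: "supermartingale M F T Y"
    and cont: "AE \<omega> in M. continuous_on {0..T} (\<lambda>t. Y t \<omega>)"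
    and Z: "integrable M Z" and dom: "AE \<omega> in M. \<forall>t\<in>{0..T}. \<bar>Y t \<omega>\<bar> \<le> Z \<omega>"
    and YT: "AE \<omega> in M. Y T \<omega> = 0"
    and t: "0 \<le> t" "t \<le> T"
    and v: "is_esssup_family M
          {\<lambda>\<omega>. ereal (real_cond_exp M (F t)
                 (\<lambda>\<omega>'. Y (\<tau> \<omega>') \<omega>' * indicator {\<omega>''. \<tau> \<omega>'' < T} \<omega>') \<omega>)
           | \<tau>. \<tau> \<in> stopping_times M F T t}
          (\<lambda>\<omega>. ereal (v \<omega>))"
  shows "AE \<omega> in M. v \<omega> = Y t \<omega>"
proof -
  interpret prob_space M by fact
  interpret complete_measure M by fact
  interpret S: finite_measure_subalgebra M "F t"
    by unfold_locales (rule sub)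
  have YI: "integrable M (Y t)" and YF: "Y t \<in> borel_measurable (F t)"
    using Y t by (auto simp: supermartingale_def)
  \<comment> \<open>The event \<open>{\<tau> = T}\<close>, on which the indicator vanishes, contributes \<open>Y T = 0\<close> anyway.\<close>
  have killed: "AE \<omega> in M. real_cond_exp M (F t)
      (\<lambda>\<omega>'. Y (\<tau> \<omega>') \<omega>' * indicator {\<omega>''. \<tau> \<omega>'' < T} \<omega>') \<omega> =
      real_cond_exp M (F t) (\<lambda>\<omega>'. Y (\<tau> \<omega>') \<omega>') \<omega>"
    if \<tau>: "\<tau> \<in> stopping_times M F T t" for \<tau>
  proof (rule S.real_cond_exp_cong)
    have m: "(\<lambda>\<omega>. Y (\<tau> \<omega>) \<omega>) \<in> borel_measurable M"
      using supermartingale_optional_sampling(1)[OF M cM sub filt Y cont Z dom t \<tau>] by auto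
    have eq: "AE \<omega> in M. Y (\<tau> \<omega>) \<omega> * indicator {\<omega>''. \<tau> \<omega>'' < T} \<omega> = Y (\<tau> \<omega>) \<omega>"
      using YT
    proof (rule AE_mp[OF _ AE_I2], intro impI)
      fix \<omega> assume "\<omega> \<in> space M" "Y T \<omega> = 0"
      moreover have "\<tau> \<omega> \<le> T" using \<tau> \<open>\<omega> \<in> space M\<close> by (auto simp: stopping_times_def)
      ultimately show "Y (\<tau> \<omega>) \<omega> * indicator {\<omega>''. \<tau> \<omega>'' < T} \<omega> = Y (\<tau> \<omega>) \<omega>"
        by (cases "\<tau> \<omega> = T") (auto simp: indicator_def)
    qed
    show "AE \<omega> in M. Y (\<tau> \<omega>) \<omega> * indicator {\<omega>''. \<tau> \<omega>'' < T} \<omega> = Y (\<tau> \<omega>) \<omega>"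
      by (rule eq)
    show "(\<lambda>\<omega>. Y (\<tau> \<omega>) \<omega>) \<in> borel_measurable M" by (rule m)
    show "(\<lambda>\<omega>. Y (\<tau> \<omega>) \<omega> * indicator {\<omega>''. \<tau> \<omega>'' < T} \<omega>) \<in> borel_measurable M"
    proof (rule measurable_AE_eq[OF m])
      show "AE \<omega> in M. Y (\<tau> \<omega>) \<omega> = Y (\<tau> \<omega>) \<omega> * indicator {\<omega>''. \<tau> \<omega>'' < T} \<omega>"
        using eq by eventually_elim simp
    qed simp
  qed
  have const: "(\<lambda>_. t) \<in> stopping_times M F T t"
    using t by (auto simp: stopping_times_def stopping_time_const)
  have "AE \<omega> in M. ereal (v \<omega>) = ereal (Y t \<omega>)"
  proof (rule esssup_family_attained[OF v])
    show "(\<lambda>\<omega>. ereal (Y t \<omega>)) \<in> borel_measurable M"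
      using YI by auto
  next
    fix f assume "f \<in> {\<lambda>\<omega>. ereal (real_cond_exp M (F t)
                 (\<lambda>\<omega>'. Y (\<tau> \<omega>') \<omega>' * indicator {\<omega>''. \<tau> \<omega>'' < T} \<omega>') \<omega>)
           | \<tau>. \<tau> \<in> stopping_times M F T t}"
    then obtain \<tau> where \<tau>: "\<tau> \<in> stopping_times M F T t"
      and f: "f = (\<lambda>\<omega>. ereal (real_cond_exp M (F t)
                 (\<lambda>\<omega>'. Y (\<tau> \<omega>') \<omega>' * indicator {\<omega>''. \<tau> \<omega>'' < T} \<omega>') \<omega>))"
      by blast
    show "AE \<omega> in M. f \<omega> \<le> ereal (Y t \<omega>)"
      using killed[OF \<tau>]
        supermartingale_optional_sampling(2)[OF M cM sub filt Y cont Z dom t \<tau>]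
      unfolding f by eventually_elim simp
  next
    show "(\<lambda>\<omega>. ereal (real_cond_exp M (F t)
                 (\<lambda>\<omega>'. Y t \<omega>' * indicator {\<omega>''. t < T} \<omega>') \<omega>)) \<in>
      {\<lambda>\<omega>. ereal (real_cond_exp M (F t)
                 (\<lambda>\<omega>'. Y (\<tau> \<omega>') \<omega>' * indicator {\<omega>''. \<tau> \<omega>'' < T} \<omega>') \<omega>)
           | \<tau>. \<tau> \<in> stopping_times M F T t}"
      by (rule CollectI, rule exI[of _ "\<lambda>_. t"]) (use const in simp)
    show "AE \<omega> in M. ereal (real_cond_exp M (F t)
        (\<lambda>\<omega>'. Y t \<omega>' * indicator {\<omega>''. t < T} \<omega>') \<omega>) = ereal (Y t \<omega>)"
      using killed[OF const] S.real_cond_exp_F_meas[OF YI YF] by eventually_elim simp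
  qed
  then show ?thesis by simp
qed

section \<open>The augmented filtration\<close>

lemma aug_filtration_subalgebra:
  assumes "wiener_process M W"
  shows "subalgebra M (aug_filtration M W t)"
proof -
  let ?G = "null_sets M \<union> {W s -` B \<inter> space M | s B. 0 \<le> s \<and> s \<le> t \<and> B \<in> sets borel}"
  have G: "?G \<subseteq> sets M"
    using assms by (auto simp: wiener_process_def intro: measurable_sets)
  then have "?G \<subseteq> Pow (space M)"
    by (rule order_trans[OF _ sets.space_closed])
  then have "sets (sigma (space M) ?G) \<subseteq> sets M"
    by (simp only: sets_measure_of sets.sigma_sets_subset[OF G])
  then show ?thesis
    by (simp add: subalgebra_def aug_filtration_def space_measure_of_conv)
qed

lemma filtration_aug_filtration: "filtration (space M) (aug_filtration M W)"
proof
  fix s t :: real assume st: "s \<le> t"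
  let ?G = "\<lambda>t. null_sets M \<union> {W r -` B \<inter> space M | r B. 0 \<le> r \<and> r \<le> t \<and> B \<in> sets borel}"
  have "?G s \<subseteq> ?G t"
    using st by fastforce
  moreover have "?G t \<subseteq> Pow (space M)" for t
    using sets.sets_into_space[of _ M] by (auto simp: null_sets_def)
  ultimately show "sets (aug_filtration M W s) \<subseteq> sets (aug_filtration M W t)"
    unfolding aug_filtration_def by (simp add: sigma_sets_subseteq)
qed (simp add: aug_filtration_def space_measure_of_conv)

section \<open>Random fields along the path\<close>

lemma AE_fst_pair_measure:
  assumes "sigma_finite_measure N" and "AE \<omega> in M. P \<omega>"
  shows "AE (\<omega>, x) in M \<Otimes>\<^sub>M N. P \<omega>"
proof -
  interpret sigma_finite_measure N by fact
  obtain A where A: "{\<omega> \<in> space M. \<not> P \<omega>} \<subseteq> A" "A \<in> null_sets M"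
    using assms(2) by (auto simp: eventually_ae_filter)
  have "A \<times> space N \<in> null_sets (M \<Otimes>\<^sub>M N)"
    using A(2) by (intro null_setsI) (auto simp: emeasure_pair_measure_Times null_sets_def)
  then show ?thesis
    unfolding eventually_ae_filter using A(1)
    by (intro bexI[of _ "A \<times> space N"]) (auto simp: space_pair_measure)
qed

text \<open>The points \<open>(\<omega>, x)\<close> whose moving point meets the exceptional set for \<open>\<epsilon> = 1 / (n + 1)\<close> for
  every \<open>n\<close> are negligible. For any other \<open>(\<omega>, x)\<close> the curve \<open>t \<mapsto> (t, x + X t)\<close> stays in a
  set on which \<open>u \<omega>\<close> is continuous.\<close>

lemma quasi_continuous_along_path:
  fixes X :: "real \<Rightarrow> 'a \<Rightarrow> real ^ 'b"
    and u :: "'a \<Rightarrow> real \<Rightarrow> real ^ 'b \<Rightarrow> real"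
  assumes M: "prob_space M" and u: "quasi_continuous M F T X u"
    and X: "AE \<omega> in M. continuous_on {0..T} (\<lambda>t. X t \<omega>)"
  shows "AE (\<omega>, x) in M \<Otimes>\<^sub>M lborel. continuous_on {0..T} (\<lambda>t. u \<omega> t (x + X t \<omega>))"
proof -
  interpret prob_space M by fact
  define good where "good D \<omega> \<longleftrightarrow>
      continuous_on ({0..T} \<times> UNIV - {(t, x). ((\<omega>, t), x) \<in> D}) (\<lambda>(t, x). u \<omega> t x)" for D \<omega>
  define hit where "hit D =
      {(\<omega>, x) \<in> space M \<times> UNIV. \<exists>t\<in>{0..T}. ((\<omega>, t), x + X t \<omega>) \<in> D}" for D
  have "\<exists>D. (AE \<omega> in M. good D \<omega>) \<and>
      outer_measure_of (M \<Otimes>\<^sub>M lborel) (hit D) \<le> ennreal (1 / real (Suc n))" for n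
  proof -
    have "1 / real (Suc n) > 0" by simp
    from u[unfolded quasi_continuous_def, rule_format, OF this, folded good_def hit_def]
    show ?thesis
      by (elim bexE conjE, intro exI conjI) (auto elim!: eventually_mono)
  qed
  then obtain D where D: "\<And>n. AE \<omega> in M. good (D n) \<omega>"
    and small: "\<And>n. outer_measure_of (M \<Otimes>\<^sub>M lborel) (hit (D n)) \<le> ennreal (1 / real (Suc n))"
    by metis
  have "AE z in M \<Otimes>\<^sub>M lborel. \<exists>n. z \<notin> hit (D n)"
    by (rule AE_notin_of_small_outer_measure[OF _ small]) (auto simp: hit_def space_pair_measure)
  moreover have "AE (\<omega>, x) in M \<Otimes>\<^sub>M (lborel :: (real ^ 'b) measure).
      (\<forall>n. good (D n) \<omega>) \<and> continuous_on {0..T} (\<lambda>t. X t \<omega>)"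
    by (rule AE_fst_pair_measure[OF lborel.sigma_finite_measure_axioms])
      (use D X in \<open>simp add: AE_all_countable\<close>)
  ultimately show ?thesis
  proof (rule AE_mp[OF AE_conjI AE_I2], intro impI)
    fix z assume z: "z \<in> space (M \<Otimes>\<^sub>M (lborel :: (real ^ 'b) measure))"
      and "(\<exists>n. z \<notin> hit (D n)) \<and>
        (case z of (\<omega>, x) \<Rightarrow> (\<forall>n. good (D n) \<omega>) \<and> continuous_on {0..T} (\<lambda>t. X t \<omega>))"
    moreover obtain \<omega> x where "z = (\<omega>, x)" by (cases z)
    ultimately obtain n where "(\<omega>, x) \<notin> hit (D n)" and "good (D n) \<omega>"
      and cX: "continuous_on {0..T} (\<lambda>t. X t \<omega>)" and "\<omega> \<in> space M"
      by (auto simp: space_pair_measure)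
    then have avoid: "((\<omega>, t), x + X t \<omega>) \<notin> D n" if "t \<in> {0..T}" for t
      using that by (auto simp: hit_def)
    have "continuous_on {0..T} (\<lambda>t. (\<lambda>(t, x). u \<omega> t x) (t, x + X t \<omega>))"
      by (rule continuous_on_compose2[OF \<open>good (D n) \<omega>\<close>[unfolded good_def]])
        (use avoid in \<open>auto intro!: continuous_intros cX\<close>)
    then show "case z of (\<omega>, x) \<Rightarrow> continuous_on {0..T} (\<lambda>t. u \<omega> t (x + X t \<omega>))"
      by (simp add: \<open>z = (\<omega>, x)\<close>)
  qed
qed

lemma field_along_path_measurable:
  assumes u: "adapted_field M F T u" and X: "X t \<in> borel_measurable M" and t: "t \<in> {0..T}"
  shows "(\<lambda>z. u (fst z) t (snd z + X t (fst z))) \<in> borel_measurable (M \<Otimes>\<^sub>M lborel)"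
proof -
  have joint: "(\<lambda>(\<omega>, t, x). u \<omega> t x) \<in> borel_measurable (M \<Otimes>\<^sub>M (restrict_space borel {0..T} \<Otimes>\<^sub>M borel))"
    using u by (simp add: adapted_field_def)
  have "(\<lambda>z. (fst z, t, snd z + X t (fst z)))
      \<in> measurable (M \<Otimes>\<^sub>M lborel) (M \<Otimes>\<^sub>M (restrict_space borel {0..T} \<Otimes>\<^sub>M borel))"
    using X t by (intro measurable_Pair) (auto simp: space_restrict_space)
  from measurable_compose[OF this joint] show ?thesis
    by simp
qed

text \<open>The supremum in the energy runs over uncountably many times and need not be measurable. The
  supremum over rational times is measurable and no larger, hence has finite integral for almost
  every \<open>x\<close>, and path continuity extends the bound to all times. Adding \<open>1\<close> turns a bound on
  the square into one on the absolute value.\<close>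

lemma AE_integrable_path_bound:
  assumes M: "prob_space M" and T: "0 < T"
    and meas: "\<And>t. t \<in> {0..T} \<Longrightarrow>
      (\<lambda>z. \<xi> (fst z) t (snd z + X t (fst z))) \<in> borel_measurable (M \<Otimes>\<^sub>M lborel)"
    and cont: "AE (\<omega>, x) in M \<Otimes>\<^sub>M lborel. continuous_on {0..T} (\<lambda>t. \<xi> \<omega> t (x + X t \<omega>))"
    and energy: "sup_energy M T X \<xi> < \<infinity>"
  shows "AE x in lborel. \<exists>Z. integrable M Z \<and> (AE \<omega> in M. \<forall>t\<in>{0..T}. \<bar>\<xi> \<omega> t (x + X t \<omega>)\<bar> \<le> Z \<omega>)"
proof -
  interpret prob_space M by fact
  interpret P: pair_sigma_finite M lborel ..
  define Q where "Q = {0..T} \<inter> \<rat>"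
  have Q: "countable Q" "Q \<subseteq> {0..T}" "closure Q = {0..T}"
    using closure_rational_interval[OF T] countable_rat by (auto simp: Q_def)
  define S where "S z = (SUP t\<in>Q. ennreal (\<bar>\<xi> (fst z) t (snd z + X t (fst z))\<bar>\<^sup>2))" for z
  have S [measurable]: "S \<in> borel_measurable (M \<Otimes>\<^sub>M lborel)"
    unfolding S_def using Q meas
    by (intro borel_measurable_SUP measurable_compose[OF _ measurable_ennreal]
        borel_measurable_power borel_measurable_abs) auto
  have "(\<integral>\<^sup>+ x. (\<integral>\<^sup>+ \<omega>. S (\<omega>, x) \<partial>M) \<partial>lborel) = (\<integral>\<^sup>+ z. S z \<partial>(M \<Otimes>\<^sub>M lborel))"
    using P.nn_integral_snd[of S] S by simp
  also have "\<dots> \<le> sup_energy M T X \<xi>"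
    unfolding sup_energy_def S_def using Q(2)
    by (intro nn_integral_mono) (auto intro!: SUP_subset_mono split: prod.split)
  also note energy
  finally have "AE x in lborel. (\<integral>\<^sup>+ \<omega>. S (\<omega>, x) \<partial>M) \<noteq> \<infinity>"
    by (intro nn_integral_PInf_AE) auto
  moreover have "AE x in lborel. AE \<omega> in M. continuous_on {0..T} (\<lambda>t. \<xi> \<omega> t (x + X t \<omega>))"
    using P.AE_pair_swapped[OF cont] by simp
  ultimately show ?thesis
  proof eventually_elim
    case (elim x)
    have [measurable]: "(\<lambda>\<omega>. S (\<omega>, x)) \<in> borel_measurable M"
      by measurable
    have fin: "AE \<omega> in M. S (\<omega>, x) \<noteq> \<infinity>"
      using elim(1) by (intro nn_integral_PInf_AE) auto
    have "(\<integral>\<^sup>+ \<omega>. ennreal (enn2real (S (\<omega>, x))) \<partial>M) \<le> (\<integral>\<^sup>+ \<omega>. S (\<omega>, x) \<partial>M)"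
      by (intro nn_integral_mono) (auto simp: ennreal_enn2real_if)
    then have "integrable M (\<lambda>\<omega>. enn2real (S (\<omega>, x)))"
      using elim(1) by (intro integrableI_nonneg) (auto simp: less_top top_unique)
    then have "integrable M (\<lambda>\<omega>. 1 + enn2real (S (\<omega>, x)))"
      by simp
    moreover have "AE \<omega> in M. \<forall>t\<in>{0..T}. \<bar>\<xi> \<omega> t (x + X t \<omega>)\<bar> \<le> 1 + enn2real (S (\<omega>, x))"
      using fin elim(2)
    proof eventually_elim
      case (elim \<omega>)
      have sq: "y \<le> 1 + y\<^sup>2" for y :: real
      proof -
        have "2 * y \<le> y\<^sup>2 + 1"
          using zero_le_power2[of "y - 1"] unfolding power2_diff by simp
        then show ?thesis
          using zero_le_power2[of y] by linarith
      qed
      have rat: "\<bar>\<xi> \<omega> t (x + X t \<omega>)\<bar> \<le> 1 + enn2real (S (\<omega>, x))" if "t \<in> Q" for t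
      proof -
        let ?y = "\<bar>\<xi> \<omega> t (x + X t \<omega>)\<bar>"
        have "ennreal (?y\<^sup>2) \<le> S (\<omega>, x)"
          unfolding S_def using that by (auto intro!: SUP_upper2)
        then have "enn2real (ennreal (?y\<^sup>2)) \<le> enn2real (S (\<omega>, x))"
          using elim(1) by (intro enn2real_mono) (auto simp: less_top)
        moreover have "?y \<le> 1 + ?y\<^sup>2"
          by (rule sq)
        ultimately show ?thesis by simp
      qed
      show ?case
      proof
        fix t assume t: "t \<in> {0..T}"
        have "continuous_on (closure Q) (\<lambda>t. \<bar>\<xi> \<omega> t (x + X t \<omega>)\<bar>)"
          unfolding Q(3) using elim(2) by (rule continuous_on_rabs)
        then show "\<bar>\<xi> \<omega> t (x + X t \<omega>)\<bar> \<le> 1 + enn2real (S (\<omega>, x))"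
          by (rule continuous_le_on_closure) (use t Q(3) rat in simp_all)
      qed
    qed
    ultimately show ?case by blast
  qed
qed

theorem corollary3p10:
  fixes M :: "'a measure"
    and W :: "real \<Rightarrow> 'a \<Rightarrow> real ^ 'm"
    and T :: real
    and U :: "(real ^ 'm ^ 'd) set"
    and \<sigma> :: "real \<Rightarrow> 'a \<Rightarrow> real ^ 'm ^ 'd"
    and X :: "real \<Rightarrow> 'a \<Rightarrow> real ^ 'd"
    and \<xi> u :: "'a \<Rightarrow> real \<Rightarrow> real ^ 'd \<Rightarrow> real"
  defines "F \<equiv> aug_filtration M W"
  assumes "T > 0"
    and "prob_space M" and "complete_measure M"
    and "wiener_process M W"
    and "U \<noteq> {}" and "bounded U"
    and "\<sigma> \<in> control_processes M W T U"
    and "is_ito_integral M W T \<sigma> X"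
    and "\<xi> \<in> LL2 M F T"
    and "AE (\<omega>, x) in M \<Otimes>\<^sub>M lborel. continuous_on {0..T} (\<lambda>t. \<xi> \<omega> t (x + X t \<omega>))"
    and "sup_energy M T X \<xi> < \<infinity>"
    and "AE x in lborel. supermartingale M F T (\<lambda>t \<omega>. \<xi> \<omega> t (x + X t \<omega>))"
    and "AE \<omega> in M. AE x in lborel. \<xi> \<omega> T x = 0"
    and "is_snell_potential M F T X \<xi> u"
  shows "(AE \<omega> in M. \<forall>t\<in>{0..T}. AE x in lborel. u \<omega> t x = \<xi> \<omega> t x) \<and>
         (AE (\<omega>, x) in M \<Otimes>\<^sub>M lborel. \<forall>t\<in>{0..T}. u \<omega> t (x + X t \<omega>) = \<xi> \<omega> t (x + X t \<omega>))"
proof -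
  interpret prob_space M by fact
  interpret P: pair_sigma_finite M "lborel :: (real ^ 'd) measure" ..
  note T = \<open>T > 0\<close>
  have sub: "subalgebra M (F t)" for t
    unfolding F_def by (rule aug_filtration_subalgebra) fact
  have filt: "filtration (space M) F"
    unfolding F_def by (rule filtration_aug_filtration)
  have XM: "X t \<in> borel_measurable M" if "t \<in> {0..T}" for t
    using \<open>is_ito_integral M W T \<sigma> X\<close> that
    by (intro measurable_from_subalg[OF sub[of t]]) (simp add: is_ito_integral_def F_def)
  have Xc: "AE \<omega> in M. continuous_on {0..T} (\<lambda>t. X t \<omega>)"
    using \<open>is_ito_integral M W T \<sigma> X\<close> by (simp add: is_ito_integral_def)
  have reg: "regular_potential M F T X u"
    and snell: "\<And>t. t \<in> {0..T} \<Longrightarrow> AE x in lborel. is_esssup_family M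
          {\<lambda>\<omega>. ereal (real_cond_exp M (F t)
                 (\<lambda>\<omega>'. \<xi> \<omega>' (\<tau> \<omega>') (x + X (\<tau> \<omega>') \<omega>') * indicator {\<omega>''. \<tau> \<omega>'' < T} \<omega>') \<omega>)
           | \<tau>. \<tau> \<in> stopping_times M F T t}
          (\<lambda>\<omega>. ereal (u \<omega> t (x + X t \<omega>)))"
    using \<open>is_snell_potential M F T X \<xi> u\<close> by (simp_all add: is_snell_potential_def)
  have \<xi>m: "(\<lambda>z. \<xi> (fst z) t (snd z + X t (fst z))) \<in> borel_measurable (M \<Otimes>\<^sub>M lborel)"
    and um: "(\<lambda>z. u (fst z) t (snd z + X t (fst z))) \<in> borel_measurable (M \<Otimes>\<^sub>M lborel)"
    if "t \<in> {0..T}" for t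
    using \<open>\<xi> \<in> LL2 M F T\<close> reg XM[OF that] that
    by (auto simp: LL2_def regular_potential_def SS2_def intro!: field_along_path_measurable)
  have uc: "AE (\<omega>, x) in M \<Otimes>\<^sub>M lborel. continuous_on {0..T} (\<lambda>t. u \<omega> t (x + X t \<omega>))"
    using reg quasi_continuous_along_path[OF \<open>prob_space M\<close> _ Xc, of F u]
    by (simp add: regular_potential_def)
  note \<xi>c = \<open>AE (\<omega>, x) in M \<Otimes>\<^sub>M lborel. continuous_on {0..T} (\<lambda>t. \<xi> \<omega> t (x + X t \<omega>))\<close>
  have terminal: "AE x in lborel. AE \<omega> in M. \<xi> \<omega> T (x + X T \<omega>) = 0"
  proof -
    have [measurable]: "(\<lambda>z. \<xi> (fst z) T (snd z + X T (fst z))) \<in> borel_measurable (M \<Otimes>\<^sub>M lborel)"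
      using T by (intro \<xi>m) auto
    have "AE \<omega> in M. AE x in lborel. \<xi> \<omega> T (x + X T \<omega>) = 0"
      using \<open>AE \<omega> in M. AE x in lborel. \<xi> \<omega> T x = 0\<close>
      by eventually_elim (rule AE_lborel_translate)
    then show ?thesis
      by (subst (asm) P.AE_commute) measurable
  qed
  have bound: "AE x in lborel. \<exists>Z. integrable M Z \<and>
      (AE \<omega> in M. \<forall>t\<in>{0..T}. \<bar>\<xi> \<omega> t (x + X t \<omega>)\<bar> \<le> Z \<omega>)"
    by (rule AE_integrable_path_bound[OF \<open>prob_space M\<close> T \<xi>m \<xi>c \<open>sup_energy M T X \<xi> < \<infinity>\<close>])
  have fixed_time: "AE (\<omega>, x) in M \<Otimes>\<^sub>M lborel. u \<omega> t (x + X t \<omega>) = \<xi> \<omega> t (x + X t \<omega>)"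
    if t: "t \<in> {0..T}" for t
  proof -
    have [measurable]:
      "(\<lambda>z. \<xi> (fst z) t (snd z + X t (fst z))) \<in> borel_measurable (M \<Otimes>\<^sub>M lborel)"
      "(\<lambda>z. u (fst z) t (snd z + X t (fst z))) \<in> borel_measurable (M \<Otimes>\<^sub>M lborel)"
      using \<xi>m[OF t] um[OF t] .
    have "AE x in lborel. AE \<omega> in M. continuous_on {0..T} (\<lambda>t. \<xi> \<omega> t (x + X t \<omega>))"
      using P.AE_pair_swapped[OF \<xi>c] by simp
    with \<open>AE x in lborel. supermartingale M F T (\<lambda>t \<omega>. \<xi> \<omega> t (x + X t \<omega>))\<close>
      terminal bound snell[OF t]
    have "AE x in lborel. AE \<omega> in M. u \<omega> t (x + X t \<omega>) = \<xi> \<omega> t (x + X t \<omega>)"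
    proof eventually_elim
      case (elim x)
      then obtain Z where Z: "integrable M Z"
        "AE \<omega> in M. \<forall>t\<in>{0..T}. \<bar>\<xi> \<omega> t (x + X t \<omega>)\<bar> \<le> Z \<omega>"
        by blast
      show ?case
        by (rule supermartingale_snell_envelope[where Y="\<lambda>t \<omega>. \<xi> \<omega> t (x + X t \<omega>)",
              OF \<open>prob_space M\<close> \<open>complete_measure M\<close> sub filt elim(1,5) Z elim(2) _ _ elim(4)])
          (use t in auto)
    qed
    then have "AE \<omega> in M. AE x in lborel. u \<omega> t (x + X t \<omega>) = \<xi> \<omega> t (x + X t \<omega>)"
      by (subst P.AE_commute) measurable
    then have "AE z in M \<Otimes>\<^sub>M lborel. u (fst z) t (snd z + X t (fst z)) = \<xi> (fst z) t (snd z + X t (fst z))"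
      by (subst (asm) P.AE_pair_iff) measurable
    then show ?thesis by (simp add: case_prod_beta)
  qed
  define Q where "Q = {0..T} \<inter> \<rat>"
  have Q: "countable Q" "Q \<subseteq> {0..T}" "closure Q = {0..T}"
    using closure_rational_interval[OF T] countable_rat by (auto simp: Q_def)
  have "AE z in M \<Otimes>\<^sub>M lborel. \<forall>t\<in>Q. case z of (\<omega>, x) \<Rightarrow> u \<omega> t (x + X t \<omega>) = \<xi> \<omega> t (x + X t \<omega>)"
    using Q fixed_time by (subst AE_ball_countable) auto
  with uc \<xi>c have all_times:
    "AE (\<omega>, x) in M \<Otimes>\<^sub>M lborel. \<forall>t\<in>{0..T}. u \<omega> t (x + X t \<omega>) = \<xi> \<omega> t (x + X t \<omega>)"
  proof eventually_elim
    case (elim z)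
    obtain \<omega> x where z: "z = (\<omega>, x)" by (cases z)
    have "u \<omega> t (x + X t \<omega>) - \<xi> \<omega> t (x + X t \<omega>) = 0" if "t \<in> {0..T}" for t
      by (rule continuous_constant_on_closure[of Q "\<lambda>t. u \<omega> t (x + X t \<omega>) - \<xi> \<omega> t (x + X t \<omega>)"])
        (use elim z Q(3) that in \<open>auto intro!: continuous_intros\<close>)
    then show ?case by (simp add: z)
  qed
  have "AE \<omega> in M. AE x in lborel. \<forall>t\<in>{0..T}. u \<omega> t (x + X t \<omega>) = \<xi> \<omega> t (x + X t \<omega>)"
    using P.AE_pair[OF all_times] by simp
  then have "AE \<omega> in M. \<forall>t\<in>{0..T}. AE x in lborel. u \<omega> t x = \<xi> \<omega> t x"
  proof eventually_elim
    case (elim \<omega>)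
    show ?case
    proof
      fix t assume t: "t \<in> {0..T}"
      have "AE x in lborel. u \<omega> t (x + X t \<omega>) = \<xi> \<omega> t (x + X t \<omega>)"
        using elim by eventually_elim (use t in blast)
      from AE_lborel_translate[OF this, of "- X t \<omega>"]
      show "AE x in lborel. u \<omega> t x = \<xi> \<omega> t x" by simp
    qed
  qed
  with all_times show ?thesis by blast
qed

end
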